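(* Let $R$ be a commutative domain, $\sigma$ an endomorphism of $R$, and $M_R$ an $R$-module. Then $R\oplus_{\sigma}M_R$ is a semicommutative right McCoy ring.
   Context: All rings are associative with identity and modules are right modules. For a commutative ring $R$, a module $M_R$ and an endomorphism $\sigma$ of $R$, the Nagata extension $R\oplus_{\sigma}M_R$ is the additive group $R\oplus M$ with the (possibly noncommutative) multiplication $(a,m)(b,n)=(ab,\,n\sigma(a)+mb)$ for $a,b\in R$, $m,n\in M$. A ring $T$ is semicommutative if for all $a,b\in T$, $ab=0$ implies $aTb=0$. A ring $T$ is right McCoy if for any nonzero polynomials $f(x),g(x)\in T[x]$, $f(x)g(x)=0$ implies $f(x)r=0$ for some nonzero $r\in T$. *)

theory Defs
  imports "HOL-Algebra.UnivPoly"
begin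

text \<open>
  Over a commutative ring a right module is the same thing as a (left) module in the sense of
  the library, so \<open>a \<odot>\<^bsub>M\<^esub> x\<close> stands for the product of \<open>x\<close> with \<open>a\<close> on the right. Thus
  \<open>(a, m)(b, n) = (ab, n \<sigma>(a) + m b)\<close> reads as below.
\<close>

definition nagata_ext ::
  "('a, 'r) ring_scheme \<Rightarrow> ('a \<Rightarrow> 'a) \<Rightarrow> ('a, 'b, 'm) module_scheme \<Rightarrow> ('a \<times> 'b) ring"
  where
  "nagata_ext R \<sigma> M =
    \<lparr> carrier = carrier R \<times> carrier M,
      mult = (\<lambda>(a, m) (b, n). (a \<otimes>\<^bsub>R\<^esub> b, \<sigma> a \<odot>\<^bsub>M\<^esub> n \<oplus>\<^bsub>M\<^esub> b \<odot>\<^bsub>M\<^esub> m)),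
      one = (\<one>\<^bsub>R\<^esub>, \<zero>\<^bsub>M\<^esub>),
      zero = (\<zero>\<^bsub>R\<^esub>, \<zero>\<^bsub>M\<^esub>),
      add = (\<lambda>(a, m) (b, n). (a \<oplus>\<^bsub>R\<^esub> b, m \<oplus>\<^bsub>M\<^esub> n)) \<rparr>"

locale semicommutative_ring = ring +
  assumes semicommutative:
    "\<lbrakk> a \<in> carrier R; b \<in> carrier R; a \<otimes> b = \<zero>; t \<in> carrier R \<rbrakk> \<Longrightarrow> a \<otimes> t \<otimes> b = \<zero>"

text \<open>
  \<open>UP R\<close> is the ring of polynomials in a central indeterminate and makes sense over a
  noncommutative \<open>R\<close>. The product \<open>f(x) r\<close> is multiplication on the right by the constant
  polynomial \<open>r\<close>; the library's \<open>smult\<close> on \<open>UP R\<close> would multiply on the left.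
\<close>

locale right_McCoy_ring = ring +
  assumes right_McCoy:
    "\<lbrakk> f \<in> carrier (UP R); g \<in> carrier (UP R);
       f \<noteq> \<zero>\<^bsub>UP R\<^esub>; g \<noteq> \<zero>\<^bsub>UP R\<^esub>; f \<otimes>\<^bsub>UP R\<^esub> g = \<zero>\<^bsub>UP R\<^esub> \<rbrakk>
     \<Longrightarrow> \<exists>r \<in> carrier R. r \<noteq> \<zero> \<and> f \<otimes>\<^bsub>UP R\<^esub> monom (UP R) r 0 = \<zero>\<^bsub>UP R\<^esub>"

end

theory Submission
  imports Defs
begin

text \<open>
  Let \<open>f = (f\<^sub>1, f\<^sub>2)\<close> and \<open>g = (g\<^sub>1, g\<^sub>2)\<close> be nonzero with \<open>f g = 0\<close>. As \<open>R\<close> is a domain, \<open>f\<^sub>1 g\<^sub>1 = 0\<close>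
  gives \<open>f\<^sub>1 = 0\<close> or \<open>g\<^sub>1 = 0\<close>. If \<open>f\<^sub>1 = 0\<close>, every element \<open>(0, n)\<close> is annihilated by \<open>f\<close>, and
  \<open>M\<close> is nonzero because \<open>f\<close> is. If \<open>g\<^sub>1 = 0\<close>, the equation says that \<open>\<sigma>(f\<^sub>1)\<close> annihilates the
  nonzero polynomial \<open>g\<^sub>2\<close> over \<open>M\<close>, and McCoy's theorem for modules over commutative rings yields
  a nonzero \<open>x\<close> in \<open>M\<close> annihilated by all coefficients of \<open>\<sigma>(f\<^sub>1)\<close>; then \<open>f (0, x) = 0\<close>.
\<close>

context module
begin

text \<open>Induction on the degree bound \<open>q\<close> of \<open>n\<close>: if some
  \<open>b i\<close> does not annihilate all of \<open>n\<close>, then \<open>b i \<odot> n\<close>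
  is again nonzero and killed by the polynomial \<open>b\<close>, but has a smaller bound. A witness
  for it serves for \<open>n\<close> as well, since the conclusion mentions only
  \<open>b\<close>.\<close>

lemma McCoy_module:
  fixes b :: "nat \<Rightarrow> 'a" and n :: "nat \<Rightarrow> 'c"
  assumes "\<And>i. b i \<in> carrier R" and "\<And>i. p \<le> i \<Longrightarrow> b i = \<zero>"
    and "\<And>j. n j \<in> carrier M" and "\<And>j. q \<le> j \<Longrightarrow> n j = \<zero>\<^bsub>M\<^esub>" and "n l \<noteq> \<zero>\<^bsub>M\<^esub>"
    and "\<And>k. (\<Oplus>\<^bsub>M\<^esub>i\<in>{..k}. b i \<odot>\<^bsub>M\<^esub> n (k - i)) = \<zero>\<^bsub>M\<^esub>"
  shows "\<exists>x\<in>carrier M. x \<noteq> \<zero>\<^bsub>M\<^esub> \<and> (\<forall>i. b i \<odot>\<^bsub>M\<^esub> x = \<zero>\<^bsub>M\<^esub>)"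
  using assms(3-6)
proof (induction q arbitrary: n l)
  case 0
  then show ?case by simp
next
  case (Suc q)
  show ?case
  proof (cases "\<exists>i j. b i \<odot>\<^bsub>M\<^esub> n j \<noteq> \<zero>\<^bsub>M\<^esub>")
    case False
    \<comment> \<open>Here \<open>n l\<close> itself is the witness.\<close>
    then show ?thesis using Suc.prems by blast
  next
    case True
    define S where "S = {i. \<exists>j. b i \<odot>\<^bsub>M\<^esub> n j \<noteq> \<zero>\<^bsub>M\<^esub>}"
    have "S \<subseteq> {..<p}"
    proof
      fix i assume "i \<in> S"
      then show "i \<in> {..<p}"
        using assms(2)[of i] Suc.prems(1) by (cases "i < p") (auto simp: S_def)
    qed
    then have fin: "finite S" by (rule finite_subset) simp
    \<comment> \<open>The largest index whose coefficient does not annihilate all of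
      \<open>n\<close>.\<close>
    define i where "i = Max S"
    have "S \<noteq> {}" using True by (auto simp: S_def)
    then have "i \<in> S" using fin by (simp add: i_def)
    then obtain j where j: "b i \<odot>\<^bsub>M\<^esub> n j \<noteq> \<zero>\<^bsub>M\<^esub>" by (auto simp: S_def)
    have above: "b i' \<odot>\<^bsub>M\<^esub> n j' = \<zero>\<^bsub>M\<^esub>" if "i < i'" for i' j'
      using Max_ge[OF fin, of i'] that by (force simp: i_def S_def)
    \<comment> \<open>In degree \<open>i + q\<close> only \<open>i' = i\<close> survives: for larger
      \<open>i'\<close> the maximality of \<open>i\<close> applies, and for smaller
      \<open>i'\<close> the index \<open>i + q - i'\<close> exceeds \<open>q\<close>, where
      \<open>n\<close> vanishes.\<close>
    have "(\<Oplus>\<^bsub>M\<^esub>i'\<in>{..i + q}. b i' \<odot>\<^bsub>M\<^esub> n (i + q - i')) =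
        (\<Oplus>\<^bsub>M\<^esub>i'\<in>{..i + q}. if i = i' then b i' \<odot>\<^bsub>M\<^esub> n q else \<zero>\<^bsub>M\<^esub>)"
    proof (rule M.finsum_cong')
      fix i' assume "i' \<in> {..i + q}"
      show "b i' \<odot>\<^bsub>M\<^esub> n (i + q - i') = (if i = i' then b i' \<odot>\<^bsub>M\<^esub> n q else \<zero>\<^bsub>M\<^esub>)"
        using above[of i'] Suc.prems(2)[of "i + q - i'"] assms(1)
        by (cases i i' rule: linorder_cases) auto
    qed (use assms(1) Suc.prems(1) in auto)
    also have "\<dots> = b i \<odot>\<^bsub>M\<^esub> n q"
      by (rule M.finsum_singleton) (use assms(1) Suc.prems(1) in auto)
    finally have top: "b i \<odot>\<^bsub>M\<^esub> n q = \<zero>\<^bsub>M\<^esub>" using Suc.prems(4) by simp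
    show ?thesis
    proof (rule Suc.IH[of "\<lambda>j. b i \<odot>\<^bsub>M\<^esub> n j" j])
      show "b i \<odot>\<^bsub>M\<^esub> n j' \<in> carrier M" for j'
        using assms(1) Suc.prems(1) by simp
      show "b i \<odot>\<^bsub>M\<^esub> n j' = \<zero>\<^bsub>M\<^esub>" if "q \<le> j'" for j'
        using that top Suc.prems(2)[of j'] assms(1) by (cases "j' = q") auto
      show "b i \<odot>\<^bsub>M\<^esub> n j \<noteq> \<zero>\<^bsub>M\<^esub>" by (fact j)
      fix k
      have "(\<Oplus>\<^bsub>M\<^esub>i'\<in>{..k}. b i' \<odot>\<^bsub>M\<^esub> (b i \<odot>\<^bsub>M\<^esub> n (k - i'))) =
          (\<Oplus>\<^bsub>M\<^esub>i'\<in>{..k}. b i \<odot>\<^bsub>M\<^esub> (b i' \<odot>\<^bsub>M\<^esub> n (k - i')))"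
        using assms(1) Suc.prems(1)
        by (intro M.finsum_cong') (auto simp flip: smult_assoc1 simp: R.m_comm)
      also have "\<dots> = b i \<odot>\<^bsub>M\<^esub> (\<Oplus>\<^bsub>M\<^esub>i'\<in>{..k}. b i' \<odot>\<^bsub>M\<^esub> n (k - i'))"
        using assms(1) Suc.prems(1) by (intro finsum_smult_ldistr[symmetric]) auto
      finally show "(\<Oplus>\<^bsub>M\<^esub>i'\<in>{..k}. b i' \<odot>\<^bsub>M\<^esub> (b i \<odot>\<^bsub>M\<^esub> n (k - i'))) = \<zero>\<^bsub>M\<^esub>"
        using Suc.prems(4)[of k] assms(1) by simp
    qed
  qed
qed

end

text \<open>The projections \<open>fst\<close> and \<open>snd\<close> let these rules rewrite
  operations on arbitrary elements, not only on explicit pairs.\<close>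

lemma nagata_ext_simps [simp]:
  "carrier (nagata_ext R \<sigma> M) = carrier R \<times> carrier M"
  "\<one>\<^bsub>nagata_ext R \<sigma> M\<^esub> = (\<one>\<^bsub>R\<^esub>, \<zero>\<^bsub>M\<^esub>)"
  "\<zero>\<^bsub>nagata_ext R \<sigma> M\<^esub> = (\<zero>\<^bsub>R\<^esub>, \<zero>\<^bsub>M\<^esub>)"
  "u \<oplus>\<^bsub>nagata_ext R \<sigma> M\<^esub> v = (fst u \<oplus>\<^bsub>R\<^esub> fst v, snd u \<oplus>\<^bsub>M\<^esub> snd v)"
  "u \<otimes>\<^bsub>nagata_ext R \<sigma> M\<^esub> v =
    (fst u \<otimes>\<^bsub>R\<^esub> fst v, \<sigma> (fst u) \<odot>\<^bsub>M\<^esub> snd v \<oplus>\<^bsub>M\<^esub> fst v \<odot>\<^bsub>M\<^esub> snd u)"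
  by (simp_all add: nagata_ext_def split: prod.splits)

locale nagata = module R M + ring_hom_cring R R \<sigma> for R (structure) and M (structure) and \<sigma>
begin

abbreviation T where "T \<equiv> nagata_ext R \<sigma> M"

text \<open>Associativity compares \<open>\<sigma>(ab)p + c(\<sigma>(a)n + bm)\<close> with
  \<open>\<sigma>(a)(\<sigma>(b)p + cn) + (bc)m\<close>; they agree as \<open>\<sigma>\<close> is
  multiplicative and \<open>R\<close> commutative.\<close>

lemma ring_nagata_ext: "ring T"
proof (rule ringI)
  show "abelian_group T"
  proof (rule abelian_groupI)
    fix u assume "u \<in> carrier T"
    then show "\<exists>v\<in>carrier T. v \<oplus>\<^bsub>T\<^esub> u = \<zero>\<^bsub>T\<^esub>"
      by (intro bexI[of _ "(\<ominus> fst u, \<ominus>\<^bsub>M\<^esub> snd u)"]) (auto simp: R.l_neg M.l_neg)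
  qed (auto simp: R.a_ac M.a_ac)
  show "Group.monoid T"
    by (rule monoidI)
      (auto simp: R.m_assoc R.m_ac M.a_assoc smult_r_distr smult_assoc1[symmetric])
qed (auto simp: R.l_distr R.r_distr smult_l_distr smult_r_distr M.a_ac)

sublocale T: ring T by (rule ring_nagata_ext)

sublocale UPT: UP_ring T "UP T"
  by unfold_locales simp

text \<open>Splits the coefficients of a product in \<open>UP T\<close> into an equation over
  \<open>R\<close> and one over \<open>M\<close>.\<close>

lemma finsum_nagata_ext:
  assumes "finite A" and "h \<in> A \<rightarrow> carrier T"
  shows "finsum T h A = (finsum R (\<lambda>i. fst (h i)) A, finsum M (\<lambda>i. snd (h i)) A)"
  using assms
proof (induction A rule: finite_induct)
  case (insert a A)
  then have "fst (h i) \<in> carrier R" "snd (h i) \<in> carrier M" if "i \<in> insert a A" for i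
    using that by (auto simp: Pi_iff mem_Times_iff)
  then show ?case
    using insert by (auto simp: T.finsum_insert R.finsum_insert M.finsum_insert)
qed simp

text \<open>One first component vanishes, so one summand of the \<open>M\<close>-equation drops out.
  Inserting \<open>t\<close> merely multiplies the remaining summand, already zero, by
  \<open>fst t\<close> or \<open>\<sigma> (fst t)\<close>.\<close>

lemma semicommutative_nagata_ext:
  assumes "domain R"
  shows "semicommutative_ring T"
proof
  interpret domain R by fact
  fix u v t
  assume uv: "u \<in> carrier T" "v \<in> carrier T" "t \<in> carrier T" and "u \<otimes>\<^bsub>T\<^esub> v = \<zero>\<^bsub>T\<^esub>"
  then have eq: "fst u \<otimes> fst v = \<zero>" "\<sigma> (fst u) \<odot>\<^bsub>M\<^esub> snd v \<oplus>\<^bsub>M\<^esub> fst v \<odot>\<^bsub>M\<^esub> snd u = \<zero>\<^bsub>M\<^esub>"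
    by auto
  have cl: "fst u \<in> carrier R" "fst v \<in> carrier R" "fst t \<in> carrier R"
    "snd u \<in> carrier M" "snd v \<in> carrier M" "snd t \<in> carrier M"
    using uv by auto
  consider "fst u = \<zero>" | "fst v = \<zero>"
    using integral eq(1) cl by blast
  then show "u \<otimes>\<^bsub>T\<^esub> t \<otimes>\<^bsub>T\<^esub> v = \<zero>\<^bsub>T\<^esub>"
  proof cases
    case 1
    then have "fst v \<odot>\<^bsub>M\<^esub> snd u = \<zero>\<^bsub>M\<^esub>" using eq(2) cl by simp
    moreover have "fst v \<odot>\<^bsub>M\<^esub> (fst t \<odot>\<^bsub>M\<^esub> snd u) = fst t \<odot>\<^bsub>M\<^esub> (fst v \<odot>\<^bsub>M\<^esub> snd u)"
      using cl by (simp add: R.m_comm flip: smult_assoc1)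
    ultimately show ?thesis using 1 cl by simp
  next
    case 2
    then have "\<sigma> (fst u) \<odot>\<^bsub>M\<^esub> snd v = \<zero>\<^bsub>M\<^esub>" using eq(2) cl by simp
    moreover have "\<sigma> (fst u \<otimes> fst t) \<odot>\<^bsub>M\<^esub> snd v = \<sigma> (fst t) \<odot>\<^bsub>M\<^esub> (\<sigma> (fst u) \<odot>\<^bsub>M\<^esub> snd v)"
      using cl by (simp add: R.m_comm flip: smult_assoc1)
    ultimately show ?thesis using 2 cl by simp
  qed
qed

text \<open>Reduces the McCoy condition to single coefficients: the constant \<open>r\<close> meets
  only \<open>f k\<close> in degree \<open>k\<close>.\<close>

lemma UP_mult_monom_eq_zero:
  assumes f: "f \<in> carrier (UP T)" and r: "r \<in> carrier T"
    and zero: "\<And>i. f i \<otimes>\<^bsub>T\<^esub> r = \<zero>\<^bsub>T\<^esub>"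
  shows "f \<otimes>\<^bsub>UP T\<^esub> monom (UP T) r 0 = \<zero>\<^bsub>UP T\<^esub>"
proof (rule UPT.up_eqI)
  fix k
  have fi: "coeff (UP T) f i = f i" "f i \<in> carrier T" for i
    using f by (auto simp: UP_def mem_upD)
  have "coeff (UP T) f i \<otimes>\<^bsub>T\<^esub> coeff (UP T) (monom (UP T) r 0) (k - i) = \<zero>\<^bsub>T\<^esub>" for i
    using fi[of i] zero[of i] T.r_null[OF fi(2)] r by (auto simp del: nagata_ext_simps)
  then show "coeff (UP T) (f \<otimes>\<^bsub>UP T\<^esub> monom (UP T) r 0) k = coeff (UP T) \<zero>\<^bsub>UP T\<^esub> k"
    using f r by (simp del: nagata_ext_simps)
qed (use f r in \<open>simp_all del: nagata_ext_simps\<close>)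

lemma right_McCoy_nagata_ext:
  assumes "domain R"
  shows "right_McCoy_ring T"
proof
  interpret domain R by fact
  interpret UPR: UP_domain R "UP R" by unfold_locales simp
  fix f g
  assume f: "f \<in> carrier (UP T)" and g: "g \<in> carrier (UP T)"
    and f0: "f \<noteq> \<zero>\<^bsub>UP T\<^esub>" and g0: "g \<noteq> \<zero>\<^bsub>UP T\<^esub>" and fg: "f \<otimes>\<^bsub>UP T\<^esub> g = \<zero>\<^bsub>UP T\<^esub>"
  have coeff: "h i \<in> carrier T" "fst (h i) \<in> carrier R" "snd (h i) \<in> carrier M"
    if "h \<in> carrier (UP T)" for h i
    using that mem_upD[of h T i] by (auto simp: UP_def)
  have bounded: "\<exists>p. \<forall>i\<ge>p. h i = (\<zero>, \<zero>\<^bsub>M\<^esub>)" if h: "h \<in> carrier (UP T)" for h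
  proof -
    obtain p where "bound \<zero>\<^bsub>T\<^esub> p h" using h by (auto simp: UP_def up_def)
    \<comment> \<open>\<open>bound\<close> speaks only of indices strictly above \<open>p\<close>,
      hence \<open>Suc p\<close>.\<close>
    then show ?thesis by (intro exI[of _ "Suc p"]) (auto simp: bound_def)
  qed
  have fst_UP: "(\<lambda>i. fst (h i)) \<in> carrier (UP R)" if h: "h \<in> carrier (UP T)" for h
  proof -
    obtain p where "\<forall>i\<ge>p. h i = (\<zero>, \<zero>\<^bsub>M\<^esub>)" using bounded[OF h] by blast
    then have "bound \<zero> p (\<lambda>i. fst (h i))" by (auto simp: bound_def)
    then show ?thesis using coeff[OF h] by (auto simp: UP_def up_def)
  qed
  have nonzero: "\<exists>i. h i \<noteq> (\<zero>, \<zero>\<^bsub>M\<^esub>)" if "h \<noteq> \<zero>\<^bsub>UP T\<^esub>" for h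
    using that by (auto simp: UP_def)
  have prod: "(\<Oplus>i\<in>{..k}. fst (f i) \<otimes> fst (g (k - i))) = \<zero>"
    "(\<Oplus>\<^bsub>M\<^esub>i\<in>{..k}. \<sigma> (fst (f i)) \<odot>\<^bsub>M\<^esub> snd (g (k - i)) \<oplus>\<^bsub>M\<^esub> fst (g (k - i)) \<odot>\<^bsub>M\<^esub> snd (f i)) = \<zero>\<^bsub>M\<^esub>"
    for k
  proof -
    have "(\<Oplus>\<^bsub>T\<^esub>i\<in>{..k}. f i \<otimes>\<^bsub>T\<^esub> g (k - i)) = (f \<otimes>\<^bsub>UP T\<^esub> g) k"
      using f g by (simp add: UP_def del: nagata_ext_simps)
    also have "\<dots> = \<zero>\<^bsub>T\<^esub>" unfolding fg by (simp add: UP_def)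
    finally have "(\<Oplus>\<^bsub>T\<^esub>i\<in>{..k}. f i \<otimes>\<^bsub>T\<^esub> g (k - i)) = \<zero>\<^bsub>T\<^esub>" .
    moreover have "(\<lambda>i. f i \<otimes>\<^bsub>T\<^esub> g (k - i)) \<in> {..k} \<rightarrow> carrier T"
      using coeff(1)[OF f] coeff(1)[OF g] by (simp del: nagata_ext_simps)
    ultimately show "(\<Oplus>i\<in>{..k}. fst (f i) \<otimes> fst (g (k - i))) = \<zero>"
      "(\<Oplus>\<^bsub>M\<^esub>i\<in>{..k}. \<sigma> (fst (f i)) \<odot>\<^bsub>M\<^esub> snd (g (k - i)) \<oplus>\<^bsub>M\<^esub> fst (g (k - i)) \<odot>\<^bsub>M\<^esub> snd (f i)) = \<zero>\<^bsub>M\<^esub>"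
      by (auto simp: finsum_nagata_ext)
  qed
  have "(\<lambda>i. fst (f i)) \<otimes>\<^bsub>UP R\<^esub> (\<lambda>i. fst (g i)) = \<zero>\<^bsub>UP R\<^esub>"
    using fst_UP[OF f] fst_UP[OF g] prod(1) by (simp add: UP_def)
  then have "(\<lambda>i. fst (f i)) = \<zero>\<^bsub>UP R\<^esub> \<or> (\<lambda>i. fst (g i)) = \<zero>\<^bsub>UP R\<^esub>"
    using UPR.integral fst_UP[OF f] fst_UP[OF g] by blast
  then consider "\<And>i. fst (f i) = \<zero>" | "\<And>i. fst (g i) = \<zero>"
    by (auto simp: UP_def fun_eq_iff)
  \<comment> \<open>Since \<open>(a, m)(0, x) = (0, \<sigma>(a)x)\<close>, such an \<open>x\<close>
    makes \<open>(\<zero>, x)\<close> annihilate every coefficient of \<open>f\<close> from the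
    right.\<close>
  then have "\<exists>x\<in>carrier M. x \<noteq> \<zero>\<^bsub>M\<^esub> \<and> (\<forall>i. \<sigma> (fst (f i)) \<odot>\<^bsub>M\<^esub> x = \<zero>\<^bsub>M\<^esub>)"
  proof cases
    case 1
    obtain i where "f i \<noteq> (\<zero>, \<zero>\<^bsub>M\<^esub>)" using nonzero[OF f0] by blast
    then have "snd (f i) \<noteq> \<zero>\<^bsub>M\<^esub>" using 1[of i] by (auto simp: prod_eq_iff)
    then show ?thesis using 1 coeff(3)[OF f] by (intro bexI[of _ "snd (f i)"]) auto
  next
    case 2
    obtain l where "g l \<noteq> (\<zero>, \<zero>\<^bsub>M\<^esub>)" using nonzero[OF g0] by blast
    then have l: "snd (g l) \<noteq> \<zero>\<^bsub>M\<^esub>" using 2[of l] by (auto simp: prod_eq_iff)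
    obtain p where p: "\<forall>i\<ge>p. f i = (\<zero>, \<zero>\<^bsub>M\<^esub>)" using bounded[OF f] by blast
    obtain q where q: "\<forall>i\<ge>q. g i = (\<zero>, \<zero>\<^bsub>M\<^esub>)" using bounded[OF g] by blast
    show ?thesis
    proof (rule McCoy_module[of "\<lambda>i. \<sigma> (fst (f i))" p "\<lambda>j. snd (g j)" q l])
      show "(\<Oplus>\<^bsub>M\<^esub>i\<in>{..k}. \<sigma> (fst (f i)) \<odot>\<^bsub>M\<^esub> snd (g (k - i))) = \<zero>\<^bsub>M\<^esub>" for k
        \<comment> \<open>The summands with factor \<open>fst (g (k - i))\<close> vanish, leaving
          the product of \<open>\<sigma>(fst f)\<close> and \<open>snd g\<close>.\<close>
        using prod(2)[of k] 2 coeff[OF f] coeff[OF g] by simp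
    qed (use p q l coeff[OF f] coeff[OF g] in auto)
  qed
  then obtain x where x: "x \<in> carrier M" "x \<noteq> \<zero>\<^bsub>M\<^esub>" "\<And>i. \<sigma> (fst (f i)) \<odot>\<^bsub>M\<^esub> x = \<zero>\<^bsub>M\<^esub>"
    by blast
  have "f \<otimes>\<^bsub>UP T\<^esub> monom (UP T) (\<zero>, x) 0 = \<zero>\<^bsub>UP T\<^esub>"
    using x coeff[OF f] by (intro UP_mult_monom_eq_zero f) auto
  then show "\<exists>r\<in>carrier T. r \<noteq> \<zero>\<^bsub>T\<^esub> \<and> f \<otimes>\<^bsub>UP T\<^esub> monom (UP T) r 0 = \<zero>\<^bsub>UP T\<^esub>"
    using x by (intro bexI[of _ "(\<zero>, x)"]) auto
qed

end

theorem proposition3p4: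
  fixes R :: "('a, 'r) ring_scheme"
    and M :: "('a, 'b, 'm) module_scheme"
    and \<sigma> :: "'a \<Rightarrow> 'a"
  assumes "domain R"
    and "\<sigma> \<in> ring_hom R R"
    and "module R M"
  shows "semicommutative_ring (nagata_ext R \<sigma> M) \<and> right_McCoy_ring (nagata_ext R \<sigma> M)"
proof -
  interpret module R M by fact
  interpret nagata R M \<sigma> by unfold_locales (fact assms(2))
  show ?thesis
    using semicommutative_nagata_ext right_McCoy_nagata_ext assms(1) by blast
qed

end
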